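(* Let $q$ be an arbitrary prime power, let $n$ be a positive integer, and let $S \subseteq \mathbb{F}_q^n \setminus \{0\}$ be a set of points such that (1) $S$ is not contained in any affine hyperplane of $\mathbb{F}_q^n$, (2) $S$ meets every affine hyperplane of $\mathbb{F}_q^n$, (3) $|S| < q^{n-2}(q-1)$. Let $f:\mathbb{F}_q^n\to\mathbb{F}_q$ be the indicator function of $S$ (i.e. $f(x)=1$ if $x\in S$ and $f(x)=0$ otherwise). Then the code $\mathcal C_f$ is a minimal code that does not satisfy the Ashikhmin–Barg condition.
   Context: A hyperplane is an $(n-1)$-dimensional subspace of $\mathbb{F}_q^n$; an affine hyperplane is a coset of a hyperplane (so hyperplanes are also affine hyperplanes). For a function $f:\mathbb{F}_q^n\to\mathbb{F}_q$, $\mathcal C_f$ is the $\mathbb{F}_q$-subspace of $\mathbb{F}_q^{q^n-1}$ spanned by the vectors $c(u,v) = (u f(x) + v\cdot x)_{x\in \mathbb{F}_q^n\setminus\{0\}}$ for $u\in\mathbb{F}_q$, $v\in\mathbb{F}_q^n$, where $v\cdot x$ is the usual dot product. The support of a vector is the set of coordinates where it is nonzero. A linear code $\mathcal C$ is minimal if for all codewords $c,c'\in\mathcal C$, $\mathrm{supp}(c)\subseteq\mathrm{supp}(c')$ implies $c=\lambda c'$ for some $\lambda\in\mathbb{F}_q^\times$. A $q$-ary linear code satisfies the Ashikhmin–Barg condition if $w_{\max}/w_{\min} < q/(q-1)$, where $w_{\min}$ and $w_{\max}$ are the minimum and maximum Hamming weights of the nonzero codewords.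
   Formalization: In the definition of a minimal code the codeword c is required to be nonzero; read literally with c = 0 allowed, the zero word's empty support would prevent any nonzero code from being minimal. *)

theory Defs
  imports "HOL-Analysis.Analysis"
begin

definition hyperplane :: "('a::field ^ 'n) set \<Rightarrow> bool" where
  "hyperplane H \<longleftrightarrow> vec.subspace H \<and> vec.dim H + 1 = CARD('n)"

definition affine_hyperplane :: "('a::field ^ 'n) set \<Rightarrow> bool" where
  "affine_hyperplane A \<longleftrightarrow> (\<exists>H a. hyperplane H \<and> A = (\<lambda>h. a + h) ` H)"

definition dot :: "'a::field ^ 'n \<Rightarrow> 'a ^ 'n \<Rightarrow> 'a" where
  "dot v x = (\<Sum>i\<in>UNIV. v $ i * x $ i)"

(* The coordinates of the code are indexed by the nonzero vectors, so its ambient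
   space is 'a ^ ('a, 'n) nonzero_vec, of dimension q^n - 1. *)
typedef (overloaded) ('a, 'n) nonzero_vec = "{x :: 'a::zero_neq_one ^ 'n::finite. x \<noteq> 0}"
  morphisms vec_of Abs_nonzero_vec
proof -
  have "(\<chi> i. 1) \<noteq> (0 :: 'a ^ 'n)"
    by (simp add: vec_eq_iff)
  then show ?thesis by blast
qed

instance nonzero_vec :: ("{zero_neq_one, finite}", finite) finite
proof
  have "inj (vec_of :: ('a, 'b) nonzero_vec \<Rightarrow> 'a ^ 'b)"
    by (simp add: inj_def vec_of_inject)
  then show "finite (UNIV :: ('a, 'b) nonzero_vec set)"
    by (rule finite_imageD[rotated]) simp
qed

definition codeword :: "('a::{field,finite} ^ 'n \<Rightarrow> 'a) \<Rightarrow> 'a \<Rightarrow> 'a ^ 'n \<Rightarrow> 'a ^ ('a, 'n) nonzero_vec" where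
  "codeword f u v = (\<chi> p. u * f (vec_of p) + dot v (vec_of p))"

definition code_of :: "('a::{field,finite} ^ 'n \<Rightarrow> 'a) \<Rightarrow> ('a ^ ('a, 'n) nonzero_vec) set" where
  "code_of f = vec.span {codeword f u v | u v. True}"

definition supp :: "'a::zero ^ 'i \<Rightarrow> 'i set" where
  "supp c = {i. c $ i \<noteq> 0}"

definition hamming_weight :: "'a::zero ^ 'i \<Rightarrow> nat" where
  "hamming_weight c = card (supp c)"

(* The codeword c is required to be nonzero: the zero word has empty support but is
   not a nonzero multiple of any other word. Then c' is nonzero as well. *)
definition minimal_code :: "('a::field ^ 'i) set \<Rightarrow> bool" where
  "minimal_code C \<longleftrightarrow>
     (\<forall>c\<in>C. \<forall>c'\<in>C. c \<noteq> 0 \<longrightarrow> supp c \<subseteq> supp c' \<longrightarrow> (\<exists>l. l \<noteq> 0 \<and> c = l *s c'))"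

definition min_weight :: "('a::zero ^ 'i) set \<Rightarrow> nat" where
  "min_weight C = Min (hamming_weight ` (C - {0}))"

definition max_weight :: "('a::zero ^ 'i) set \<Rightarrow> nat" where
  "max_weight C = Max (hamming_weight ` (C - {0}))"

definition ashikhmin_barg :: "('a::{field,finite} ^ 'i) set \<Rightarrow> bool" where
  "ashikhmin_barg C \<longleftrightarrow>
     real (max_weight C) / real (min_weight C) < real CARD('a) / (real CARD('a) - 1)"

end

theory Submission
  imports Defs
begin

text \<open>Suppose that \<open>v\<close> is not a multiple of \<open>w\<close>. The vectors orthogonal to \<open>w\<close> form a subspace
  of dimension at least \<open>n - 1\<close>, and those orthogonal to \<open>v\<close> as well have codimension 1 in it, so at
  least \<open>q\<^sup>n\<^sup>-\<^sup>2 (q - 1)\<close> vectors are orthogonal to \<open>w\<close> but not to \<open>v\<close>; by (3) one of them lies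
  outside \<open>S\<close>. It is a zero of \<open>c(u', w)\<close> but not of \<open>c(u, v)\<close>, whatever \<open>u\<close> and \<open>u'\<close> are, so an
  inclusion of supports forces \<open>v\<close> to be a multiple of \<open>w\<close>. That \<open>u\<close> is the same multiple of \<open>u'\<close>
  is seen at a point \<open>x\<close> of \<open>S\<close> with \<open>w \<cdot> x = - u'\<close>, which exists by (2). The Ashikhmin-Barg
  condition fails because \<open>c(1, 0)\<close> has weight \<open>|S|\<close>, whereas \<open>c(0, v)\<close> has weight
  \<open>q\<^sup>n\<^sup>-\<^sup>1 (q - 1)\<close> for \<open>v \<noteq> 0\<close>.\<close>

lemma dot_commute: "dot v x = dot x v"
  by (simp add: dot_def mult.commute)

lemma dot_add_right: "dot v (x + y) = dot v x + dot v y"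
  by (simp add: dot_def algebra_simps sum.distrib)

lemma dot_scale_right: "dot v (l *s x) = l * dot v x"
  by (simp add: dot_def sum_distrib_left algebra_simps)

lemma dot_add_left: "dot (v + w) x = dot v x + dot w x"
  by (simp add: dot_commute[of _ x] dot_add_right)

lemma dot_scale_left: "dot (l *s v) x = l * dot v x"
  by (simp add: dot_commute[of _ x] dot_scale_right)

lemma dot_zero_right [simp]: "dot v 0 = 0"
  by (simp add: dot_def)

lemma dot_zero_left [simp]: "dot 0 x = 0"
  by (simp add: dot_def)

lemma dot_diff_right: "dot v (x - y) = dot v x - dot v y"
  using dot_add_right[of v "x - y" y] by simp

lemma matrix_vector_mult_nth: "(A *v x) $ i = dot (A $ i) x"
  by (simp add: matrix_vector_mult_def dot_def)

definition annihilator :: "('a::field ^ 'n) set \<Rightarrow> ('a ^ 'n) set" where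
  "annihilator B = {x. \<forall>w\<in>B. dot w x = 0}"

lemma annihilator_empty [simp]: "annihilator {} = UNIV"
  by (simp add: annihilator_def)

lemma annihilator_insert: "annihilator (insert v B) = {x \<in> annihilator B. dot v x = 0}"
  by (auto simp: annihilator_def)

lemma subspace_annihilator: "vec.subspace (annihilator B)"
  by (simp add: vec.subspace_def annihilator_def dot_add_right dot_scale_right)

lemma annihilator_span: "annihilator (vec.span B) = annihilator B"
proof (intro equalityI subsetI)
  fix x assume x: "x \<in> annihilator B"
  have "dot w x = 0" if "w \<in> vec.span B" for w
    using that
  proof (induction rule: vec.span_induct_alt)
    case (step l v w)
    then show ?case using x by (simp add: annihilator_def dot_add_left dot_scale_left)
  qed simp
  then show "x \<in> annihilator (vec.span B)" by (simp add: annihilator_def)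
qed (auto simp: annihilator_def vec.span_base)

lemma exists_annihilator_dot_eq_one:
  fixes v :: "'a::field ^ 'n"
  assumes "v \<notin> vec.span B"
  shows "\<exists>a\<in>annihilator B. dot v a = 1"
proof -
  obtain C where C: "C \<subseteq> B" "vec.independent C" "B \<subseteq> vec.span C"
    by (rule vec.maximal_independent_subset)
  have "v \<notin> vec.span C" using assms vec.span_mono[OF C(1)] by blast
  then have "vec.independent (insert v C)" using C(2) by (rule vec.independent_insertI)
  then obtain g :: "'a ^ 'n \<Rightarrow> 'a ^ 1"
    where linear: "Vector_Spaces.linear (*s) (*s) g"
      and g: "\<forall>x\<in>insert v C. g x = (if x = v then 1 else 0)"
    using vec.linear_independent_extend[of "insert v C" "\<lambda>x. if x = v then 1 else 0"] by blast
  define a where "a = matrix g $ 1"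
  have dot_a: "dot w a = g w $ 1" for w
    unfolding a_def dot_commute[of w] matrix_vector_mult_nth[symmetric]
    by (simp only: matrix_works[OF linear])
  have "dot w a = 0" if "w \<in> C" for w
    using that g \<open>v \<notin> vec.span C\<close> by (auto simp: dot_a dest: vec.span_base)
  then have "a \<in> annihilator (vec.span C)"
    unfolding annihilator_span by (simp add: annihilator_def)
  then have "a \<in> annihilator B" using C(3) by (auto simp: annihilator_def)
  moreover have "dot v a = 1" using g by (simp add: dot_a)
  ultimately show ?thesis by blast
qed

lemma dim_annihilator_insert:
  assumes "v \<notin> vec.span B"
  shows "vec.dim (annihilator (insert v B)) + 1 = vec.dim (annihilator B)"
proof -
  let ?A = "annihilator (insert v B)"
  obtain a where a: "a \<in> annihilator B" "dot v a = 1"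
    using exists_annihilator_dot_eq_one[OF assms] by blast
  have "x \<in> vec.span (insert a ?A)" if x: "x \<in> annihilator B" for x
  proof -
    have "x - dot v x *s a \<in> annihilator B"
      by (intro vec.subspace_diff vec.subspace_scale subspace_annihilator x a)
    then have "x - dot v x *s a \<in> ?A"
      by (simp add: annihilator_insert dot_diff_right dot_scale_right a)
    then show ?thesis unfolding vec.span_breakdown_eq by (blast intro: vec.span_base)
  qed
  then have "vec.span (insert a ?A) = annihilator B"
    using a by (intro vec.span_subspace subspace_annihilator) (auto simp: annihilator_insert)
  moreover have "a \<notin> vec.span ?A"
    unfolding vec.span_eq_iff[THEN iffD2, OF subspace_annihilator]
    using a by (simp add: annihilator_insert)
  ultimately show ?thesis by (metis vec.dim_insert vec.dim_span)
qed

lemma dim_annihilator: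
  fixes B :: "('a::field ^ 'n) set"
  shows "vec.dim (annihilator B) + vec.dim B = CARD('n)"
proof -
  obtain C where C: "C \<subseteq> B" "vec.independent C" "B \<subseteq> vec.span C"
    by (rule vec.maximal_independent_subset)
  then have "vec.span C = vec.span B"
    by (intro equalityI vec.span_mono vec.span_minimal vec.subspace_span)
  moreover have "vec.dim (annihilator C) + vec.dim C = CARD('n)"
    using vec.finiteI_independent[OF C(2)]
  proof (induction C rule: finite_induct)
    case empty
    show ?case by (simp add: card_cart_basis)
  next
    case (insert v C)
    show ?case
    proof (cases "v \<in> vec.span C")
      case True
      then have "annihilator (insert v C) = annihilator C"
        by (metis annihilator_span vec.span_redundant)
      then show ?thesis using True insert.IH by (simp add: vec.dim_insert)
    next
      case False
      then show ?thesis
        using dim_annihilator_insert[OF False] insert.IH by (simp add: vec.dim_insert)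
    qed
  qed
  ultimately show ?thesis by (metis annihilator_span vec.dim_span)
qed

lemma hyperplane_annihilator:
  assumes "v \<noteq> 0"
  shows "hyperplane (annihilator {v})"
  unfolding hyperplane_def using dim_annihilator[of "{v}"] assms by (simp add: subspace_annihilator)

lemma affine_hyperplane_dot_eq:
  assumes "v \<noteq> 0"
  shows "affine_hyperplane {x. dot v x = s}"
proof -
  obtain a where a: "dot v a = 1"
    using exists_annihilator_dot_eq_one[of v "{}"] assms by auto
  have "{x. dot v x = s} = (\<lambda>h. s *s a + h) ` annihilator {v}"
  proof (intro equalityI subsetI)
    fix x assume "x \<in> {x. dot v x = s}"
    then have "x - s *s a \<in> annihilator {v}"
      by (simp add: annihilator_def dot_diff_right dot_scale_right a)
    then show "x \<in> (\<lambda>h. s *s a + h) ` annihilator {v}" by (rule rev_image_eqI) simp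
  qed (auto simp: annihilator_def dot_add_right dot_scale_right a)
  then show ?thesis
    unfolding affine_hyperplane_def using hyperplane_annihilator[OF assms] by blast
qed

lemma card_span_insert:
  fixes a :: "'a::{field,finite} ^ 'n"
  assumes "a \<notin> vec.span B"
  shows "card (vec.span (insert a B)) = CARD('a) * card (vec.span B)"
proof -
  let ?g = "\<lambda>(k, x). x + k *s a"
  have "k = l \<and> x = y"
    if x: "x \<in> vec.span B" and y: "y \<in> vec.span B" and eq: "x + k *s a = y + l *s a" for k l x y
  proof -
    have "(k - l) *s a = y - x" using eq by (simp add: algebra_simps)
    then have multiple: "(k - l) *s a \<in> vec.span B" using vec.span_diff[OF y x] by simp
    have "k = l"
    proof (rule ccontr)
      assume "k \<noteq> l"
      then have "a = inverse (k - l) *s ((k - l) *s a)"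
        by (simp only: vec.scale_scale) simp
      then show False using vec.span_scale[OF multiple] assms by metis
    qed
    then show ?thesis using eq by simp
  qed
  then have "inj_on ?g (UNIV \<times> vec.span B)"
    unfolding inj_on_def by fast
  moreover have "vec.span (insert a B) = ?g ` (UNIV \<times> vec.span B)"
  proof (intro equalityI subsetI)
    fix x assume "x \<in> vec.span (insert a B)"
    then obtain k where "x - k *s a \<in> vec.span B" by (auto simp: vec.span_breakdown_eq)
    then show "x \<in> ?g ` (UNIV \<times> vec.span B)"
      by (intro image_eqI[of _ _ "(k, x - k *s a)"]) auto
  qed (auto intro: vec.span_add vec.span_scale vec.span_base vec.span_mono[THEN subsetD, rotated])
  ultimately show ?thesis by (simp add: card_image card_cartesian_product)
qed

lemma card_span:
  fixes B :: "('a::{field,finite} ^ 'n) set"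
  shows "card (vec.span B) = CARD('a) ^ vec.dim B"
  using finite[of B]
proof (induction B rule: finite_induct)
  case (insert a B)
  then show ?case
    by (cases "a \<in> vec.span B") (simp_all add: vec.span_redundant vec.dim_insert card_span_insert)
qed simp

lemma card_annihilator:
  fixes B :: "('a::{field,finite} ^ 'n) set"
  shows "card (annihilator B) = CARD('a) ^ (CARD('n) - vec.dim B)"
proof -
  have "vec.dim (annihilator B) = CARD('n) - vec.dim B"
    using dim_annihilator[of B] by linarith
  then show ?thesis
    using card_span[of "annihilator B"] vec.span_eq_iff[THEN iffD2, OF subspace_annihilator, of B]
    by simp
qed

lemma card_annihilator_Diff_insert:
  fixes v :: "'a::{field,finite} ^ 'n"
  assumes "v \<notin> vec.span B"
  shows "card (annihilator B - annihilator (insert v B))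
           = CARD('a) ^ (CARD('n) - vec.dim B - 1) * (CARD('a) - 1)"
proof -
  have "CARD('n) - vec.dim B = Suc (CARD('n) - vec.dim B - 1)"
    using dim_annihilator[of B] dim_annihilator_insert[OF assms] by linarith
  moreover have "annihilator (insert v B) \<subseteq> annihilator B"
    by (auto simp: annihilator_insert)
  ultimately show ?thesis
    using assms
    by (simp add: card_Diff_subset card_annihilator vec.dim_insert diff_mult_distrib mult.commute)
qed

lemma codeword_add: "codeword f (u + u') (v + v') = codeword f u v + codeword f u' v'"
  by (simp add: codeword_def vec_eq_iff dot_add_left algebra_simps)

lemma codeword_scale: "codeword f (l * u) (l *s v) = l *s codeword f u v"
  by (simp add: codeword_def vec_eq_iff dot_scale_left algebra_simps)

lemma codeword_zero [simp]: "codeword f 0 0 = 0"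
  by (simp add: codeword_def vec_eq_iff)

lemma code_of_eq: "code_of f = {codeword f u v | u v. True}"
proof -
  have "vec.subspace {codeword f u v | u v. True}"
  proof (rule vec.subspaceI)
    show "0 \<in> {codeword f u v | u v. True}"
      using codeword_zero[of f] by (metis (mono_tags, lifting) mem_Collect_eq)
  qed (auto simp flip: codeword_add codeword_scale, blast+)
  then show ?thesis unfolding code_of_def by (rule vec.span_eq_iff[THEN iffD2])
qed

lemma inj_vec_of: "inj vec_of"
  by (simp add: inj_def vec_of_inject)

lemma vec_of_image_supp_codeword:
  "vec_of ` supp (codeword f u v) = {x. x \<noteq> 0 \<and> u * f x + dot v x \<noteq> 0}"
proof -
  have "range vec_of = {x. x \<noteq> 0}"
    by (rule type_definition.Rep_range[OF type_definition_nonzero_vec])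
  moreover have "supp (codeword f u v) = vec_of -` {x. u * f x + dot v x \<noteq> 0}"
    by (simp add: supp_def codeword_def vimage_def)
  ultimately show ?thesis by (simp only: image_vimage_eq) blast
qed

lemma supp_codeword_subset_iff:
  "supp (codeword f u v) \<subseteq> supp (codeword f u' v')
     \<longleftrightarrow> (\<forall>x. x \<noteq> 0 \<and> u' * f x + dot v' x = 0 \<longrightarrow> u * f x + dot v x = 0)"
  unfolding inj_image_subset_iff[OF inj_vec_of, symmetric] vec_of_image_supp_codeword by blast

lemma hamming_weight_codeword:
  "hamming_weight (codeword f u v) = card {x. x \<noteq> 0 \<and> u * f x + dot v x \<noteq> 0}"
  unfolding hamming_weight_def vec_of_image_supp_codeword[symmetric]
  by (simp add: card_image inj_on_subset[OF inj_vec_of])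

lemma hamming_weight_linear_codeword:
  fixes v :: "'a::{field,finite} ^ 'n"
  assumes "v \<noteq> 0"
  shows "hamming_weight (codeword f 0 v) = CARD('a) ^ (CARD('n) - 1) * (CARD('a) - 1)"
proof -
  have "{x. x \<noteq> 0 \<and> dot v x \<noteq> 0} = annihilator {} - annihilator {v}"
    by (auto simp: annihilator_def)
  then show ?thesis
    using card_annihilator_Diff_insert[of v "{}"] assms by (simp add: hamming_weight_codeword)
qed

lemma exists_orthogonal_to_one_only_outside:
  fixes S :: "('a::{field,finite} ^ 'n) set"
  assumes small: "real (card S) < real CARD('a) powi (int CARD('n) - 2) * (real CARD('a) - 1)"
    and indep: "v \<notin> vec.span {w}"
  shows "\<exists>x. x \<notin> S \<and> dot w x = 0 \<and> dot v x \<noteq> 0"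
proof -
  let ?A = "annihilator {w} - annihilator {v, w}"
  let ?m = "CARD('n) - vec.dim {w} - 1"
  have "vec.dim {w} \<le> 1" by simp
  then have "int CARD('n) - 2 \<le> int ?m" by linarith
  then have "real CARD('a) powi (int CARD('n) - 2) \<le> real CARD('a) powi int ?m"
    by (rule power_int_increasing) (simp add: Suc_leI)
  then have "real CARD('a) powi (int CARD('n) - 2) * (real CARD('a) - 1)
      \<le> real CARD('a) ^ ?m * (real CARD('a) - 1)"
    by (intro mult_right_mono) (simp_all add: Suc_leI)
  also have "\<dots> = real (card ?A)"
    unfolding card_annihilator_Diff_insert[OF indep] by (simp add: Suc_leI)
  finally have "card S < card ?A" using small by simp
  then have "\<not> ?A \<subseteq> S" using card_mono[of S ?A] by auto
  then show ?thesis by (auto simp: annihilator_def)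
qed

lemma codeword_multiple_if_supp_subset:
  fixes f :: "'a::{field,finite} ^ 'n \<Rightarrow> 'a"
  assumes separating: "\<And>v w. v \<notin> vec.span {w} \<Longrightarrow> \<exists>x. f x = 0 \<and> dot w x = 0 \<and> dot v x \<noteq> 0"
    and meet: "\<And>u w. w \<noteq> 0 \<Longrightarrow> \<exists>x. x \<noteq> 0 \<and> f x \<noteq> 0 \<and> u * f x + dot w x = 0"
    and supp: "supp (codeword f u v) \<subseteq> supp (codeword f u' w)"
  shows "\<exists>l. codeword f u v = l *s codeword f u' w"
proof -
  have zero: "u * f x + dot v x = 0" if "x \<noteq> 0" "u' * f x + dot w x = 0" for x
    using supp that unfolding supp_codeword_subset_iff by blast
  have "v \<in> vec.span {w}"
  proof (rule ccontr)
    assume "v \<notin> vec.span {w}"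
    then obtain x where x: "f x = 0" "dot w x = 0" "dot v x \<noteq> 0" using separating by blast
    then have "x \<noteq> 0" by auto
    then show False using zero[of x] x by simp
  qed
  then obtain l where l: "v = l *s w" by (auto simp: vec.span_singleton)
  have "\<exists>l. u = l * u' \<and> v = l *s w"
  proof (cases "w = 0")
    case True
    obtain x where x: "x \<noteq> 0" "f x \<noteq> 0" using meet[of 1] by auto
    have "u = 0" if "u' = 0" using zero[of x] x that True l by simp
    then have "u = (u / u') * u'" by auto
    then show ?thesis using l True by (metis vec.scale_zero_right)
  next
    case False
    then obtain x where x: "x \<noteq> 0" "f x \<noteq> 0" "u' * f x + dot w x = 0" using meet by blast
    have "u * f x + l * dot w x = 0" using zero[of x] x by (simp add: l dot_scale_left)
    moreover have "dot w x = - (u' * f x)" using x(3) by (simp add: eq_neg_iff_add_eq_0 add.commute)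
    ultimately have "(u - l * u') * f x = 0" by (simp add: algebra_simps)
    then show ?thesis using l x(2) by auto
  qed
  then show ?thesis by (metis codeword_scale)
qed

lemma minimal_code_code_of_if_small_support:
  fixes f :: "'a::{field,finite} ^ 'n \<Rightarrow> 'a"
  assumes small: "real (card {x. f x \<noteq> 0})
      < real CARD('a) powi (int CARD('n) - 2) * (real CARD('a) - 1)"
    and meet: "\<And>u w. w \<noteq> 0 \<Longrightarrow> \<exists>x. x \<noteq> 0 \<and> f x \<noteq> 0 \<and> u * f x + dot w x = 0"
  shows "minimal_code (code_of f)"
  unfolding minimal_code_def
proof (intro ballI impI)
  fix c c' assume "c \<in> code_of f" "c' \<in> code_of f" and "c \<noteq> 0"
    and supp: "supp c \<subseteq> supp c'"
  then obtain u v u' w where c: "c = codeword f u v" and c': "c' = codeword f u' w"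
    unfolding code_of_eq by blast
  have "\<exists>x. f x = 0 \<and> dot w x = 0 \<and> dot v x \<noteq> 0" if "v \<notin> vec.span {w}" for v w
    using exists_orthogonal_to_one_only_outside[OF small that] by simp
  then obtain l where "c = l *s c'"
    using codeword_multiple_if_supp_subset[OF _ meet supp[unfolded c c']] unfolding c c' by blast
  moreover from this have "l \<noteq> 0" using \<open>c \<noteq> 0\<close> by auto
  ultimately show "\<exists>l. l \<noteq> 0 \<and> c = l *s c'" by blast
qed

lemma hamming_weight_pos_iff: "0 < hamming_weight c \<longleftrightarrow> c \<noteq> 0"
  by (simp add: hamming_weight_def supp_def vec_eq_iff card_gt_0_iff)

lemma one_less_card_UNIV: "1 < CARD('a::{zero_neq_one,finite})"
  using card_mono[of UNIV "{0, 1 :: 'a}"] by simp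

lemma not_ashikhmin_bargI:
  fixes C :: "('a::{field,finite} ^ 'i) set"
  assumes c: "c \<in> C" "c \<noteq> 0" and c': "c' \<in> C"
    and ratio: "CARD('a) * hamming_weight c \<le> (CARD('a) - 1) * hamming_weight c'"
  shows "\<not> ashikhmin_barg C"
proof -
  let ?q = "CARD('a)"
  have q: "1 < ?q" by (rule one_less_card_UNIV)
  have "0 < ?q * hamming_weight c" using q c(2) by (simp add: hamming_weight_pos_iff)
  then have "0 < (?q - 1) * hamming_weight c'" using ratio by (rule less_le_trans)
  then have "c' \<noteq> 0" by (simp add: hamming_weight_pos_iff)
  then have max: "hamming_weight c' \<le> max_weight C"
    unfolding max_weight_def using c' by (intro Max_ge) auto
  have min: "min_weight C \<le> hamming_weight c"
    unfolding min_weight_def using c by (intro Min_le) auto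
  have "min_weight C \<in> hamming_weight ` (C - {0})"
    unfolding min_weight_def using c by (intro Min_in) auto
  then obtain d where "d \<in> C" "d \<noteq> 0" "min_weight C = hamming_weight d" by blast
  then have "0 < min_weight C" by (simp add: hamming_weight_pos_iff)
  have "?q * min_weight C \<le> ?q * hamming_weight c" using min by (rule mult_le_mono2)
  also note ratio
  also have "(?q - 1) * hamming_weight c' \<le> (?q - 1) * max_weight C"
    using max by (rule mult_le_mono2)
  finally have "real (?q * min_weight C) \<le> real ((?q - 1) * max_weight C)"
    by (simp only: of_nat_le_iff)
  then have "real ?q / (real ?q - 1) \<le> real (max_weight C) / real (min_weight C)"
    using q \<open>0 < min_weight C\<close> by (simp add: pos_divide_le_eq pos_le_divide_eq mult_ac)
  then show ?thesis by (simp add: ashikhmin_barg_def)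
qed

lemma not_ashikhmin_barg_code_of_if_small_support:
  fixes f :: "'a::{field,finite} ^ 'n \<Rightarrow> 'a"
  assumes small: "real (card {x. f x \<noteq> 0})
      < real CARD('a) powi (int CARD('n) - 2) * (real CARD('a) - 1)"
    and nonzero: "x \<noteq> 0" "f x \<noteq> 0"
  shows "\<not> ashikhmin_barg (code_of f)"
proof (rule not_ashikhmin_bargI)
  let ?q = "CARD('a)"
  show "codeword f 1 0 \<in> code_of f" "codeword f 0 1 \<in> code_of f"
    unfolding code_of_eq by blast+
  have weight: "hamming_weight (codeword f 1 0) = card {x. x \<noteq> 0 \<and> f x \<noteq> 0}"
    by (simp add: hamming_weight_codeword)
  then show "codeword f 1 0 \<noteq> 0"
    unfolding hamming_weight_pos_iff[of "codeword f 1 0", symmetric]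
    using nonzero by (auto simp: card_gt_0_iff)
  have q: "1 < ?q" by (rule one_less_card_UNIV)
  have exponent: "int (CARD('n) - 1) = int CARD('n) - 2 + 1" by (simp add: Suc_leI)
  have power: "real ?q ^ (CARD('n) - 1) = real ?q powi (int CARD('n) - 2) * real ?q"
    unfolding power_int_of_nat[symmetric] exponent by (rule power_int_add_1) simp
  have "hamming_weight (codeword f 1 0) \<le> card {x. f x \<noteq> 0}"
    unfolding weight by (intro card_mono) auto
  then have "real ?q * real (hamming_weight (codeword f 1 0))
      \<le> real ?q * (real ?q powi (int CARD('n) - 2) * (real ?q - 1))"
    using small by (intro mult_left_mono) auto
  also have "\<dots> = real ?q ^ (CARD('n) - 1) * (real ?q - 1)"
    unfolding power by simp
  also have "\<dots> = real (hamming_weight (codeword f 0 1))"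
    using q by (simp add: hamming_weight_linear_codeword)
  finally have "?q * hamming_weight (codeword f 1 0) \<le> hamming_weight (codeword f 0 1)"
    by (simp only: of_nat_mult[symmetric] of_nat_le_iff)
  also have "\<dots> \<le> (?q - 1) * hamming_weight (codeword f 0 1)"
    using q by (cases "?q - 1") auto
  finally show "?q * hamming_weight (codeword f 1 0) \<le> (?q - 1) * hamming_weight (codeword f 0 1)" .
qed

theorem theorem1:
  fixes S :: "('a::{field,finite} ^ 'n) set"
    and f :: "'a ^ 'n \<Rightarrow> 'a"
  assumes "S \<subseteq> UNIV - {0}"
    and "\<not> (\<exists>A. affine_hyperplane A \<and> S \<subseteq> A)"
    and "\<And>A. affine_hyperplane A \<Longrightarrow> S \<inter> A \<noteq> {}"
    and "real (card S) < real CARD('a) powi (int CARD('n) - 2) * (real CARD('a) - 1)"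
    and "f = indicator S"
  shows "minimal_code (code_of f) \<and> \<not> ashikhmin_barg (code_of f)"
proof
  have small: "real (card {x. f x \<noteq> 0})
      < real CARD('a) powi (int CARD('n) - 2) * (real CARD('a) - 1)"
    using assms(4) by (simp add: assms(5) indicator_eq_0_iff)
  have meet: "\<exists>x. x \<noteq> 0 \<and> f x \<noteq> 0 \<and> u * f x + dot w x = 0" if "w \<noteq> 0" for u w
  proof -
    obtain x where "x \<in> S" "dot w x = - u"
      using assms(3)[OF affine_hyperplane_dot_eq[OF \<open>w \<noteq> 0\<close>]] by blast
    then show ?thesis using assms(1) by (intro exI[of _ x]) (auto simp: assms(5))
  qed
  show "minimal_code (code_of f)"
    using small meet by (rule minimal_code_code_of_if_small_support)
  obtain x where "x \<noteq> 0" "f x \<noteq> 0" using meet[of 1] by auto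
  with small show "\<not> ashikhmin_barg (code_of f)"
    by (rule not_ashikhmin_barg_code_of_if_small_support)
qed

end
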